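(* Let $\mathbf P=[\mathbf p_{\mathrm c},\mathbf p_1,\dots,\mathbf p_K]\in\mathbb C^{N_t\times(K+1)}$, let $k\in\{1,\dots,K\}$, and let $\widehat R_{\mathrm c,k}$, $\widehat R_k$ be the conservative worst-case rates defined in the context for the uncertainty ball $\mathbb H_k$ of center $\widehat{\mathbf h}_k$ and radius $\delta_k$. Let $\widetilde{\mathbf h}_k$ be drawn from an arbitrary zero-mean isotropic distribution defined over the origin-centered ball of radius $\delta_k$ in $\mathbb C^{N_t}$, so that $\mathrm E\{\widetilde{\mathbf h}_k\}=\mathbf 0$ and $\mathrm E\{\widetilde{\mathbf h}_k\widetilde{\mathbf h}_k^H\}=\sigma_{\mathrm e,k}^2\mathbf I$, and set $\mathbf R_k=\widehat{\mathbf h}_k\widehat{\mathbf h}_k^H+\sigma_{\mathrm e,k}^2\mathbf I$. Then the conservative worst-case rates are upper-bounded by $$\widehat R_{\mathrm c,k}\le\log_2(1+\widehat\gamma_{\mathrm c,k})\quad\text{and}\quad\widehat R_k\le\log_2(1+\widehat\gamma_k),$$ where $\widehat\gamma_{\mathrm c,k}$ and $\widehat\gamma_k$ are upper-bounds on the equivalent conservative worst-case SINRs, defined as $$\widehat\gamma_{\mathrm c,k}=\frac{|\mathbf p_{\mathrm c}^H\widehat{\mathbf h}_k|^2}{\widehat I_{\mathrm c,k}+\widetilde I_{\mathrm c,k}},\qquad\widehat\gamma_k=\frac{|\mathbf p_k^H\widehat{\mathbf h}_k|^2}{\widehat I_k+\widetilde I_k},$$ with $\widehat I_{\mathrm c,k}=\sum_{i=1}^K\mathbf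 p_i^H\mathbf R_k\mathbf p_i+\sigma_{\mathrm n}^2$, $\widehat I_k=\sum_{i\ne k}\mathbf p_i^H\mathbf R_k\mathbf p_i+\sigma_{\mathrm n}^2$, $\widetilde I_{\mathrm c,k}=\sigma_{\mathrm e,k}^2\|\mathbf p_{\mathrm c}\|^2$ and $\widetilde I_k=\sigma_{\mathrm e,k}^2\|\mathbf p_k\|^2$.
   Context: Setting. $K\le N_t$, noise variance $\sigma_{\mathrm n}^2>0$, and $\mathbb H_k=\{\mathbf h\in\mathbb C^{N_t}:\|\mathbf h-\widehat{\mathbf h}_k\|\le\delta_k\}$ for a given channel estimate $\widehat{\mathbf h}_k\in\mathbb C^{N_t}$ and $\delta_k\ge0$. For a channel $\mathbf h_k$ and scalar equalizers $g_{\mathrm c,k},g_k\in\mathbb C$, the common and private mean square errors are $$\varepsilon_{\mathrm c,k}=|g_{\mathrm c,k}|^2T_{\mathrm c,k}-2\Re\{g_{\mathrm c,k}\mathbf h_k^H\mathbf p_{\mathrm c}\}+1,\qquad\varepsilon_k=|g_k|^2T_k-2\Re\{g_k\mathbf h_k^H\mathbf p_k\}+1,$$ with $T_k=\sum_{i=1}^K|\mathbf h_k^H\mathbf p_i|^2+\sigma_{\mathrm n}^2$ and $T_{\mathrm c,k}=|\mathbf h_k^H\mathbf p_{\mathrm c}|^2+T_k$. For positive weights $u_{\mathrm c,k},u_k$ the augmented weighted MSEs are $$\xi_{\mathrm c,k}(\mathbf h_k,g_{\mathrm c,k},u_{\mathrm c,k})=u_{\mathrm c,k}\varepsilon_{\mathrm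 c,k}-\log_2(u_{\mathrm c,k}),\qquad\xi_k(\mathbf h_k,g_k,u_k)=u_k\varepsilon_k-\log_2(u_k).$$ The conservative worst-case rates (equalizers and weights do not depend on the channel realization) are $$\widehat R_{\mathrm c,k}=1-\min_{\widehat u_{\mathrm c,k},\,\widehat g_{\mathrm c,k}}\ \max_{\mathbf h_k\in\mathbb H_k}\xi_{\mathrm c,k}(\mathbf h_k,\widehat g_{\mathrm c,k},\widehat u_{\mathrm c,k}),\qquad\widehat R_k=1-\min_{\widehat u_k,\,\widehat g_k}\ \max_{\mathbf h_k\in\mathbb H_k}\xi_k(\mathbf h_k,\widehat g_k,\widehat u_k),$$ the minima being over positive weights and complex equalizers.
   Formalization: The augmented weighted MSEs use the natural logarithm instead of log_2, and the rates (1 − min max ξ) are divided by ln 2; with log_2 as written the bounds fail, e.g. for zero precoders and δ_k = 0, where the rates are about 0.086 > 0. *)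

theory Defs
  imports "HOL-Probability.Probability"
begin

text \<open>The product \<open>x\<^sup>H y\<close>; the library's inner product on \<^typ>\<open>complex ^ 'n\<close> is only its real part.\<close>

definition hprod :: "complex ^ 'n \<Rightarrow> complex ^ 'n \<Rightarrow> complex" where
  "hprod x y = (\<Sum>i\<in>UNIV. cnj (x $ i) * y $ i)"

text \<open>The rank-one matrix \<open>x y\<^sup>H\<close>.\<close>

definition outer :: "complex ^ 'n \<Rightarrow> complex ^ 'n \<Rightarrow> complex ^ 'n ^ 'n" where
  "outer x y = (\<chi> i j. x $ i * cnj (y $ j))"

text \<open>\<open>x\<^sup>H A x\<close> as a real number; it is used for Hermitian \<open>A\<close> only, where the
  imaginary part vanishes.\<close>

definition qform :: "complex ^ 'n ^ 'n \<Rightarrow> complex ^ 'n \<Rightarrow> real" where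
  "qform A x = Re (hprod x (A *v x))"

text \<open>Throughout, \<open>\<sigma>\<^sub>n\<^sup>2\<close> is the noise variance, \<open>pc\<close> is the common precoder and
  \<open>p 1, \<dots>, p K\<close> are the private precoders.\<close>

definition rx_power :: "real \<Rightarrow> nat \<Rightarrow> (nat \<Rightarrow> complex ^ 'n) \<Rightarrow> complex ^ 'n \<Rightarrow> real" where
  "rx_power \<sigma>\<^sub>n K p h = (\<Sum>i=1..K. (cmod (hprod h (p i)))\<^sup>2) + \<sigma>\<^sub>n\<^sup>2"

definition rx_power_c ::
  "real \<Rightarrow> nat \<Rightarrow> complex ^ 'n \<Rightarrow> (nat \<Rightarrow> complex ^ 'n) \<Rightarrow> complex ^ 'n \<Rightarrow> real" where
  "rx_power_c \<sigma>\<^sub>n K pc p h = (cmod (hprod h pc))\<^sup>2 + rx_power \<sigma>\<^sub>n K p h"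

definition mse_c ::
  "real \<Rightarrow> nat \<Rightarrow> complex ^ 'n \<Rightarrow> (nat \<Rightarrow> complex ^ 'n) \<Rightarrow> complex ^ 'n \<Rightarrow> complex \<Rightarrow> real" where
  "mse_c \<sigma>\<^sub>n K pc p h g =
     (cmod g)\<^sup>2 * rx_power_c \<sigma>\<^sub>n K pc p h - 2 * Re (g * hprod h pc) + 1"

definition mse ::
  "real \<Rightarrow> nat \<Rightarrow> (nat \<Rightarrow> complex ^ 'n) \<Rightarrow> nat \<Rightarrow> complex ^ 'n \<Rightarrow> complex \<Rightarrow> real" where
  "mse \<sigma>\<^sub>n K p k h g =
     (cmod g)\<^sup>2 * rx_power \<sigma>\<^sub>n K p h - 2 * Re (g * hprod h (p k)) + 1"

text \<open>
  The logarithm in the augmented weighted MSE has to be the natural one. Minimising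
  \<open>u \<epsilon> - ln u\<close> over \<open>u > 0\<close> gives \<open>1 + ln \<epsilon>\<close> (at \<open>u = 1 / \<epsilon>\<close>), so that one minus the
  minimum is the rate \<open>- ln \<epsilon>\<close> in nats, and dividing by \<open>ln 2\<close> gives the rate in bits.
  With \<open>u \<epsilon> - log\<^sub>2 u\<close> the minimiser is \<open>u = 1 / (\<epsilon> ln 2)\<close>, and one minus the minimum
  exceeds \<open>- log\<^sub>2 \<epsilon>\<close> by the constant \<open>1 - (1 + ln (ln 2)) / ln 2 > 0\<close>; the claimed bounds
  then fail already for a known channel and zero precoders.
\<close>

definition awmse_c ::
  "real \<Rightarrow> nat \<Rightarrow> complex ^ 'n \<Rightarrow> (nat \<Rightarrow> complex ^ 'n)
    \<Rightarrow> complex ^ 'n \<Rightarrow> complex \<Rightarrow> real \<Rightarrow> real" where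
  "awmse_c \<sigma>\<^sub>n K pc p h g u = u * mse_c \<sigma>\<^sub>n K pc p h g - ln u"

definition awmse ::
  "real \<Rightarrow> nat \<Rightarrow> (nat \<Rightarrow> complex ^ 'n) \<Rightarrow> nat
    \<Rightarrow> complex ^ 'n \<Rightarrow> complex \<Rightarrow> real \<Rightarrow> real" where
  "awmse \<sigma>\<^sub>n K p k h g u = u * mse \<sigma>\<^sub>n K p k h g - ln u"

text \<open>
  Conservative worst-case rates, in bits, for the uncertainty ball \<^term>\<open>cball hhat \<delta>\<close>.
  For \<open>\<delta> \<ge> 0\<close> and \<open>\<sigma>\<^sub>n\<^sup>2 > 0\<close> the supremum is a maximum (a continuous function on a compact
  set) and the infimum is a minimum (a positive MSE that is coercive in \<open>g\<close>), so the
  values on unbounded or empty sets play no role.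
\<close>

definition rate_c ::
  "real \<Rightarrow> nat \<Rightarrow> complex ^ 'n \<Rightarrow> (nat \<Rightarrow> complex ^ 'n) \<Rightarrow> complex ^ 'n \<Rightarrow> real \<Rightarrow> real" where
  "rate_c \<sigma>\<^sub>n K pc p hhat \<delta> =
     (1 - (INF (u, g) \<in> {0<..} \<times> UNIV. SUP h \<in> cball hhat \<delta>. awmse_c \<sigma>\<^sub>n K pc p h g u)) / ln 2"

definition rate ::
  "real \<Rightarrow> nat \<Rightarrow> (nat \<Rightarrow> complex ^ 'n) \<Rightarrow> nat \<Rightarrow> complex ^ 'n \<Rightarrow> real \<Rightarrow> real" where
  "rate \<sigma>\<^sub>n K p k hhat \<delta> =
     (1 - (INF (u, g) \<in> {0<..} \<times> UNIV. SUP h \<in> cball hhat \<delta>. awmse \<sigma>\<^sub>n K p k h g u)) / ln 2"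

text \<open>A zero-mean isotropic random vector in the ball of radius \<open>\<delta>\<close>: isotropy means that the
  covariance matrix is the multiple \<open>\<sigma>\<^sub>e\<^sup>2\<close> of the identity. In particular this holds, for a
  suitable \<open>\<sigma>\<^sub>e\<close>, for every unitarily invariant distribution on the ball.\<close>

definition isotropic_error ::
  "'a measure \<Rightarrow> ('a \<Rightarrow> complex ^ 'n) \<Rightarrow> real \<Rightarrow> real \<Rightarrow> bool" where
  "isotropic_error M X \<delta> \<sigma>\<^sub>e \<longleftrightarrow>
     prob_space M \<and> X \<in> borel_measurable M \<and>
     (AE \<omega> in M. X \<omega> \<in> cball 0 \<delta>) \<and>
     prob_space.expectation M X = 0 \<and>
     prob_space.expectation M (\<lambda>\<omega>. outer (X \<omega>) (X \<omega>)) = mat (complex_of_real (\<sigma>\<^sub>e\<^sup>2))"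

definition corr_matrix :: "complex ^ 'n \<Rightarrow> real \<Rightarrow> complex ^ 'n ^ 'n" where
  "corr_matrix hhat \<sigma>\<^sub>e = outer hhat hhat + mat (complex_of_real (\<sigma>\<^sub>e\<^sup>2))"

definition sinr_bound_c ::
  "real \<Rightarrow> nat \<Rightarrow> complex ^ 'n \<Rightarrow> (nat \<Rightarrow> complex ^ 'n) \<Rightarrow> complex ^ 'n \<Rightarrow> real \<Rightarrow> real" where
  "sinr_bound_c \<sigma>\<^sub>n K pc p hhat \<sigma>\<^sub>e =
     (let I_hat = (\<Sum>i=1..K. qform (corr_matrix hhat \<sigma>\<^sub>e) (p i)) + \<sigma>\<^sub>n\<^sup>2;
          I_tilde = \<sigma>\<^sub>e\<^sup>2 * (norm pc)\<^sup>2
      in (cmod (hprod pc hhat))\<^sup>2 / (I_hat + I_tilde))"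

definition sinr_bound ::
  "real \<Rightarrow> nat \<Rightarrow> (nat \<Rightarrow> complex ^ 'n) \<Rightarrow> nat \<Rightarrow> complex ^ 'n \<Rightarrow> real \<Rightarrow> real" where
  "sinr_bound \<sigma>\<^sub>n K p k hhat \<sigma>\<^sub>e =
     (let I_hat = (\<Sum>i\<in>{1..K} - {k}. qform (corr_matrix hhat \<sigma>\<^sub>e) (p i)) + \<sigma>\<^sub>n\<^sup>2;
          I_tilde = \<sigma>\<^sub>e\<^sup>2 * (norm (p k))\<^sup>2
      in (cmod (hprod (p k) hhat))\<^sup>2 / (I_hat + I_tilde))"

end

theory Submission imports Defs begin

text \<open>
  For fixed equalizer and weight, the worst case over the ball dominates the average over
  \<open>hhat + htilde\<close>. That average is again a weighted MSE \<open>u \<epsilon> - ln u\<close>, with the first and second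
  moments of the channel in place of the channel. It is at least \<open>1 + ln \<epsilon>\<close>, and completing the
  square in the equalizer gives \<open>\<epsilon> \<ge> 1 / (1 + \<gamma>)\<close>.
\<close>

lemma linear_hprod_left: "linear (\<lambda>x. hprod x q)"
  by (rule linearI)
    (simp_all add: hprod_def distrib_right sum.distrib scaleR_sum_right)

lemma linear_qform: "linear (\<lambda>A. qform A q)"
  by (rule linearI)
    (simp_all add: qform_def hprod_def matrix_vector_mult_def distrib_left distrib_right
      sum.distrib scaleR_sum_right sum_distrib_left Re_sum)

text \<open>\<open>hprod\<close> is conjugate-linear in its first argument, so linearity holds over
  the reals only. That is enough to exchange it with the expectation, and in finite dimension
  boundedness is automatic.\<close>

lemma bounded_linear_hprod_left: "bounded_linear (\<lambda>x. hprod x q)"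
  using linear_hprod_left linear_conv_bounded_linear by blast

lemma bounded_linear_qform: "bounded_linear (\<lambda>A. qform A q)"
  using linear_qform linear_conv_bounded_linear by blast

lemma continuous_on_hprod_left [continuous_intros]:
  "continuous_on S f \<Longrightarrow> continuous_on S (\<lambda>x. hprod (f x) q)"
  by (rule bounded_linear.continuous_on [OF bounded_linear_hprod_left])

lemma continuous_on_outer: "continuous_on S (\<lambda>x. outer x x)"
  unfolding outer_def by (intro continuous_intros)

lemma cnj_hprod: "cnj (hprod x y) = hprod y x"
  by (simp add: hprod_def mult.commute)

lemma cmod_hprod_commute: "cmod (hprod x y) = cmod (hprod y x)"
  by (metis cnj_hprod complex_mod_cnj)

text \<open>This is the link between matrix moments and received power: through it, the mean of
  \<open>outer x x\<close> determines the mean power along every precoder.\<close>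

lemma qform_outer: "qform (outer x x) q = (cmod (hprod x q))\<^sup>2"
proof -
  have "outer x x *v q = (\<chi> i. x $ i * hprod x q)"
    by (simp add: outer_def matrix_vector_mult_def hprod_def vec_eq_iff sum_distrib_left mult.assoc)
  then have "hprod q (outer x x *v q) = hprod q x * hprod x q"
    by (simp add: hprod_def [of q] sum_distrib_right mult.assoc)
  also have "\<dots> = complex_of_real ((cmod (hprod x q))\<^sup>2)"
    by (metis cnj_hprod complex_norm_square mult.commute)
  finally show ?thesis
    by (simp add: qform_def)
qed

lemma qform_mat: "qform (mat (complex_of_real c)) q = c * (norm q)\<^sup>2"
proof -
  have "mat (complex_of_real c) *v q = (\<chi> i. complex_of_real c * q $ i)"
    by (simp add: mat_def matrix_vector_mult_def vec_eq_iff if_distrib [where f = "\<lambda>x. x * _"]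
        cong: if_cong)
  then have "hprod q (mat (complex_of_real c) *v q)
      = (\<Sum>i\<in>UNIV. complex_of_real (c * (cmod (q $ i))\<^sup>2))"
    by (simp add: hprod_def complex_norm_square mult_ac del: of_real_power)
  then show ?thesis
    by (simp add: qform_def norm_vec_def L2_set_def sum_nonneg sum_distrib_left)
qed

text \<open>The first summand is the power received through the channel estimate, the second the
  mean leakage due to the estimation error. For the desired stream the former becomes the signal and
  the latter becomes \<open>I_tilde\<close>.\<close>

lemma qform_corr_matrix:
  "qform (corr_matrix h s) q = (cmod (hprod h q))\<^sup>2 + s\<^sup>2 * (norm q)\<^sup>2"
  by (simp only: corr_matrix_def linear_add [OF linear_qform] qform_outer qform_mat)

text \<open>A continuous function is bounded on a compact set, and an almost surely bounded
  measurable function is integrable over a probability space.\<close>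

lemma (in prob_space) integrable_continuous_comp:
  fixes f :: "'b::metric_space \<Rightarrow> 'c::{banach, second_countable_topology}"
  assumes X: "X \<in> borel_measurable M" and K: "AE \<omega> in M. X \<omega> \<in> K" "compact K"
    and f: "continuous_on UNIV f"
  shows "integrable M (\<lambda>\<omega>. f (X \<omega>))"
proof -
  have "bounded (f ` K)"
    using K(2) f by (meson compact_continuous_image compact_imp_bounded continuous_on_subset top_greatest)
  then obtain B where B: "\<And>x. x \<in> K \<Longrightarrow> norm (f x) \<le> B"
    by (auto simp: bounded_iff)
  have "f \<in> borel_measurable borel"
    using f by (rule borel_measurable_continuous_onI)
  then have "(\<lambda>\<omega>. f (X \<omega>)) \<in> borel_measurable M"
    using X by measurable
  moreover have "AE \<omega> in M. norm (f (X \<omega>)) \<le> B"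
    using K(1) B by (auto elim: AE_mp)
  ultimately show ?thesis
    by (intro integrable_const_bound)
qed

text \<open>An average never exceeds the worst case. Compactness makes the image bounded above,
  without which the real supremum would not be an upper bound.\<close>

lemma (in prob_space) expectation_le_SUP_compact:
  fixes f :: "'b::metric_space \<Rightarrow> real"
  assumes X: "X \<in> borel_measurable M" and K: "AE \<omega> in M. X \<omega> \<in> K" "compact K"
    and f: "continuous_on UNIV f"
  shows "expectation (\<lambda>\<omega>. f (X \<omega>)) \<le> (SUP x\<in>K. f x)"
proof -
  have "compact (f ` K)"
    using K(2) f by (meson compact_continuous_image continuous_on_subset top_greatest)
  then have "bdd_above (f ` K)"
    by (simp add: bounded_imp_bdd_above compact_imp_bounded)
  then have "AE \<omega> in M. f (X \<omega>) \<le> (SUP x\<in>K. f x)"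
    using K(1) by (auto intro: cSUP_upper elim: AE_mp)
  then have "expectation (\<lambda>\<omega>. f (X \<omega>)) \<le> expectation (\<lambda>_. SUP x\<in>K. f x)"
    using integrable_continuous_comp [OF assms] by (intro integral_mono_AE) auto
  then show ?thesis
    by (simp add: prob_space)
qed

text \<open>The zero mean removes every term that is linear in the error, and the isotropic
  covariance turns the quadratic term into a multiple of the squared norm of
  \<open>q\<close>.\<close>

lemma channel_moments:
  fixes X :: "'a \<Rightarrow> complex ^ 'n"
  assumes iso: "isotropic_error M X \<delta> s"
  shows "prob_space.expectation M (\<lambda>\<omega>. hprod (h + X \<omega>) q) = hprod h q"
    and "prob_space.expectation M (\<lambda>\<omega>. (cmod (hprod (h + X \<omega>) q))\<^sup>2)
       = qform (corr_matrix h s) q"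
proof -
  interpret prob_space M
    using iso by (simp add: isotropic_error_def)
  have X: "X \<in> borel_measurable M" "AE \<omega> in M. X \<omega> \<in> cball 0 \<delta>"
    and E: "expectation X = 0"
    and EO: "expectation (\<lambda>\<omega>. outer (X \<omega>) (X \<omega>)) = mat (complex_of_real (s\<^sup>2))"
    using iso by (auto simp: isotropic_error_def)
  note int = integrable_continuous_comp [OF X compact_cball]
  have intX: "integrable M X"
    using int [of "\<lambda>x. x"] by (simp add: continuous_on_id)
  have intO: "integrable M (\<lambda>\<omega>. outer (X \<omega>) (X \<omega>))"
    by (rule int) (rule continuous_on_outer)
  have add: "hprod (h + x) q = hprod h q + hprod x q" for x
    by (rule linear_add [OF linear_hprod_left])
  have intP: "integrable M (\<lambda>\<omega>. hprod (X \<omega>) q)"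
    by (intro int continuous_intros)
  have EP: "expectation (\<lambda>\<omega>. hprod (X \<omega>) q) = 0"
    using integral_bounded_linear [OF bounded_linear_hprod_left intX, of q] E
    by (simp add: linear_0 [OF linear_hprod_left])
  show "expectation (\<lambda>\<omega>. hprod (h + X \<omega>) q) = hprod h q"
    using intP EP by (simp add: add prob_space)
  have intQ: "integrable M (\<lambda>\<omega>. (cmod (hprod (X \<omega>) q))\<^sup>2)"
    by (intro int continuous_intros)
  have EQ: "expectation (\<lambda>\<omega>. (cmod (hprod (X \<omega>) q))\<^sup>2) = s\<^sup>2 * (norm q)\<^sup>2"
    using integral_bounded_linear [OF bounded_linear_qform intO, of q]
    by (simp only: qform_outer EO qform_mat)
  \<comment> \<open>The cross term in the expansion of the squared modulus of
    \<open>hprod h q + hprod x q\<close>.\<close>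
  let ?L = "\<lambda>x. 2 * Re (cnj (hprod h q) * hprod x q)"
  have intL: "integrable M (\<lambda>\<omega>. ?L (X \<omega>))"
    by (intro int continuous_intros)
  have EL: "expectation (\<lambda>\<omega>. ?L (X \<omega>)) = 0"
    \<comment> \<open>The product under \<open>Re\<close> is kept whole, so that the expectation
      passes through \<open>Re\<close> and the constant factor to
      \<open>hprod (X \<omega>) q\<close>.\<close>
    using intP EP by (simp del: times_complex.sel)
  have "(cmod (hprod (h + x) q))\<^sup>2 = (cmod (hprod h q))\<^sup>2 + ?L x + (cmod (hprod x q))\<^sup>2" for x
    by (simp add: add cmod_power2) (simp add: power2_eq_square algebra_simps)
  then show "expectation (\<lambda>\<omega>. (cmod (hprod (h + X \<omega>) q))\<^sup>2) = qform (corr_matrix h s) q"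
    using intL intQ EL EQ by (simp add: prob_space qform_corr_matrix del: times_complex.sel)
qed

text \<open>The right-hand side is a convex quadratic in \<open>g\<close>, smallest at the MMSE
  equalizer \<open>cnj b / ((cmod b)\<^sup>2 + I)\<close>. Its value there is
  \<open>I / ((cmod b)\<^sup>2 + I)\<close>, which is the left-hand side.\<close>

lemma mse_lower_bound:
  fixes g b :: complex and I :: real
  assumes "I > 0"
  shows "1 / (1 + (cmod b)\<^sup>2 / I) \<le> (cmod g)\<^sup>2 * ((cmod b)\<^sup>2 + I) - 2 * Re (g * b) + 1"
proof -
  define x where "x = cmod g"
  define y where "y = cmod b"
  have T: "y\<^sup>2 + I > 0"
    using assms by (simp add: add_nonneg_pos)
  \<comment> \<open>The phase of \<open>g\<close> enters only through this term, so the best phase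
    leaves a real quadratic in the modulus \<open>x\<close>, for which the square can be
    completed.\<close>
  have "Re (g * b) \<le> x * y"
    unfolding x_def y_def by (metis complex_Re_le_cmod norm_mult)
  moreover have "1 / (1 + y\<^sup>2 / I) \<le> x\<^sup>2 * (y\<^sup>2 + I) - 2 * (x * y) + 1"
  proof -
    have "x\<^sup>2 * (y\<^sup>2 + I) - 2 * (x * y) + 1 - I / (y\<^sup>2 + I) = (x * (y\<^sup>2 + I) - y)\<^sup>2 / (y\<^sup>2 + I)"
      using T by (simp add: field_simps power2_eq_square)
    moreover have "\<dots> \<ge> 0"
      using T by simp
    moreover have "1 / (1 + y\<^sup>2 / I) = I / (y\<^sup>2 + I)"
      using assms T by (simp add: field_simps)
    ultimately show ?thesis
      by linarith
  qed
  ultimately show ?thesis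
    unfolding x_def y_def by linarith
qed

text \<open>The inequality \<open>ln x \<le> x - 1\<close> at \<open>x = u * e\<close>; equality
  holds for the weight \<open>u = 1 / e\<close>.\<close>

lemma weighted_mse_ge:
  fixes u e :: real
  assumes "u > 0" "e > 0"
  shows "1 + ln e \<le> u * e - ln u"
  using ln_le_minus_one [of "u * e"] assms by (simp add: ln_mult)

text \<open>Common and private streams differ only in the total power \<open>T\<close> and the
  effective channel \<open>b\<close>, so one statement serves both. \<open>I\<close> is the part of
  the mean total power not carried by the mean effective channel.\<close>

lemma (in prob_space) worst_case_rate_le:
  fixes T :: "'b::metric_space \<Rightarrow> real" and b :: "'b \<Rightarrow> complex"
  assumes H: "H \<in> borel_measurable M" "AE \<omega> in M. H \<omega> \<in> C" "compact C"
    and cont: "continuous_on UNIV T" "continuous_on UNIV b"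
    and Eb: "expectation (\<lambda>\<omega>. b (H \<omega>)) = \<beta>"
    and ET: "expectation (\<lambda>\<omega>. T (H \<omega>)) = (cmod \<beta>)\<^sup>2 + I"
    and I: "I > 0"
  shows "(1 - (INF (u, g) \<in> {0<..} \<times> UNIV. SUP h \<in> C.
            u * ((cmod g)\<^sup>2 * T h - 2 * Re (g * b h) + 1) - ln u)) / ln 2
         \<le> log 2 (1 + (cmod \<beta>)\<^sup>2 / I)"
proof -
  let ?\<gamma> = "(cmod \<beta>)\<^sup>2 / I"
  let ?\<xi> = "\<lambda>u g h. u * ((cmod g)\<^sup>2 * T h - 2 * Re (g * b h) + 1) - ln u"
  have \<gamma>: "1 + ?\<gamma> > 0"
    using I by (simp add: add_pos_nonneg)
  have int: "integrable M (\<lambda>\<omega>. T (H \<omega>))" "integrable M (\<lambda>\<omega>. b (H \<omega>))"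
    using integrable_continuous_comp [OF H] cont by auto
  have "1 - ln (1 + ?\<gamma>) \<le> (SUP h \<in> C. ?\<xi> u g h)" if u: "u > 0" for u g
  proof -
    let ?e = "(cmod g)\<^sup>2 * ((cmod \<beta>)\<^sup>2 + I) - 2 * Re (g * \<beta>) + 1"
    have e: "1 / (1 + ?\<gamma>) \<le> ?e"
      using I by (rule mse_lower_bound)
    moreover have pos: "0 < 1 / (1 + ?\<gamma>)"
      using \<gamma> by simp
    ultimately have "ln (1 / (1 + ?\<gamma>)) \<le> ln ?e"
      by (intro ln_mono) auto
    then have "1 - ln (1 + ?\<gamma>) \<le> 1 + ln ?e"
      using \<gamma> by (simp add: ln_div)
    also have "\<dots> \<le> u * ?e - ln u"
      using u e pos by (intro weighted_mse_ge) linarith+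
    \<comment> \<open>For \<open>u\<close> and \<open>g\<close> that do not depend on the channel,
      the weighted MSE is affine in \<open>T\<close> and \<open>Re (g * b)\<close>, so averaging
      merely substitutes their means.\<close>
    also have "\<dots> = expectation (\<lambda>\<omega>. ?\<xi> u g (H \<omega>))"
      using int by (simp add: prob_space Eb ET del: times_complex.sel)
    also have "\<dots> \<le> (SUP h \<in> C. ?\<xi> u g h)"
      using H by (rule expectation_le_SUP_compact) (intro continuous_intros cont)
    finally show ?thesis .
  qed
  then have "1 - ln (1 + ?\<gamma>) \<le> (INF (u, g) \<in> {0<..} \<times> UNIV. SUP h \<in> C. ?\<xi> u g h)"
    \<comment> \<open>The lower bound is uniform in \<open>u\<close> and \<open>g\<close>, and the
      index set is nonempty, so it passes to the infimum.\<close>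
    by (intro cINF_greatest) auto
  then show ?thesis
    by (simp add: log_def divide_right_mono)
qed

theorem lemma1:
  fixes pc :: "complex ^ 'n" and p :: "nat \<Rightarrow> complex ^ 'n" and hhat :: "complex ^ 'n"
    and K k :: nat and \<sigma>\<^sub>n \<sigma>\<^sub>e \<delta> :: real
    and M :: "'a measure" and htilde :: "'a \<Rightarrow> complex ^ 'n"
  assumes "K \<le> CARD('n)"
    and "k \<in> {1..K}"
    and "\<sigma>\<^sub>n\<^sup>2 > 0"
    and "\<delta> \<ge> 0"
    and "isotropic_error M htilde \<delta> \<sigma>\<^sub>e"
  shows "rate_c \<sigma>\<^sub>n K pc p hhat \<delta> \<le> log 2 (1 + sinr_bound_c \<sigma>\<^sub>n K pc p hhat \<sigma>\<^sub>e)
       \<and> rate \<sigma>\<^sub>n K p k hhat \<delta> \<le> log 2 (1 + sinr_bound \<sigma>\<^sub>n K p k hhat \<sigma>\<^sub>e)"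
proof
  interpret prob_space M
    using assms(5) by (simp add: isotropic_error_def)
  let ?H = "\<lambda>\<omega>. hhat + htilde \<omega>"
  let ?Q = "qform (corr_matrix hhat \<sigma>\<^sub>e)"
  have H: "?H \<in> borel_measurable M" "AE \<omega> in M. ?H \<omega> \<in> cball hhat \<delta>"
    using assms(5) by (auto simp: isotropic_error_def dist_norm)
  note mom = channel_moments [OF assms(5), of hhat]
  have int: "integrable M (\<lambda>\<omega>. (cmod (hprod (?H \<omega>) q))\<^sup>2)" for q
    by (rule integrable_continuous_comp [OF H compact_cball]) (intro continuous_intros)
  have ET: "expectation (\<lambda>\<omega>. rx_power \<sigma>\<^sub>n K p (?H \<omega>)) = (\<Sum>i=1..K. ?Q (p i)) + \<sigma>\<^sub>n\<^sup>2"
    and intT: "integrable M (\<lambda>\<omega>. rx_power \<sigma>\<^sub>n K p (?H \<omega>))"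
    using int mom(2) by (simp_all add: rx_power_def prob_space)
  have cont: "continuous_on UNIV (rx_power \<sigma>\<^sub>n K p)" "continuous_on UNIV (rx_power_c \<sigma>\<^sub>n K pc p)"
    unfolding rx_power_def rx_power_c_def by (intro continuous_intros)+
  have Q: "?Q q \<ge> 0" for q
    by (simp add: qform_corr_matrix)
  note bound = worst_case_rate_le [OF H compact_cball]
  \<comment> \<open>The denominators of the two SINR bounds: the mean total power minus the power of
    the desired stream received through \<open>hhat\<close>.\<close>
  let ?Ic = "(\<Sum>i=1..K. ?Q (p i)) + \<sigma>\<^sub>n\<^sup>2 + \<sigma>\<^sub>e\<^sup>2 * (norm pc)\<^sup>2"
  let ?I = "(\<Sum>i\<in>{1..K} - {k}. ?Q (p i)) + \<sigma>\<^sub>n\<^sup>2 + \<sigma>\<^sub>e\<^sup>2 * (norm (p k))\<^sup>2"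
  have "rate_c \<sigma>\<^sub>n K pc p hhat \<delta> \<le> log 2 (1 + (cmod (hprod hhat pc))\<^sup>2 / ?Ic)"
    unfolding rate_c_def awmse_c_def mse_c_def
  proof (rule bound)
    show "expectation (\<lambda>\<omega>. rx_power_c \<sigma>\<^sub>n K pc p (?H \<omega>)) = (cmod (hprod hhat pc))\<^sup>2 + ?Ic"
      using int intT ET mom(2) by (simp add: rx_power_c_def qform_corr_matrix)
    show "?Ic > 0"
      using assms(3) Q by (intro add_pos_nonneg add_nonneg_pos sum_nonneg) auto
  qed (intro cont continuous_intros mom(1))+
  then show "rate_c \<sigma>\<^sub>n K pc p hhat \<delta> \<le> log 2 (1 + sinr_bound_c \<sigma>\<^sub>n K pc p hhat \<sigma>\<^sub>e)"
    by (simp add: sinr_bound_c_def Let_def cmod_hprod_commute [of pc])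
  have "rate \<sigma>\<^sub>n K p k hhat \<delta> \<le> log 2 (1 + (cmod (hprod hhat (p k)))\<^sup>2 / ?I)"
    unfolding rate_def awmse_def mse_def
  proof (rule bound)
    \<comment> \<open>The private power sum includes the desired stream \<open>k\<close>. Once it is
      split off, its estimate part is the signal power and its error part joins the
      interference.\<close>
    have "(\<Sum>i=1..K. ?Q (p i)) = ?Q (p k) + (\<Sum>i\<in>{1..K} - {k}. ?Q (p i))"
      using assms(2) by (intro sum.remove) auto
    then show "expectation (\<lambda>\<omega>. rx_power \<sigma>\<^sub>n K p (?H \<omega>)) = (cmod (hprod hhat (p k)))\<^sup>2 + ?I"
      using ET qform_corr_matrix [of hhat \<sigma>\<^sub>e "p k"] by linarith
    show "?I > 0"
      using assms(3) Q by (intro add_pos_nonneg add_nonneg_pos sum_nonneg) auto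
  qed (intro cont continuous_intros mom(1))+
  then show "rate \<sigma>\<^sub>n K p k hhat \<delta> \<le> log 2 (1 + sinr_bound \<sigma>\<^sub>n K p k hhat \<sigma>\<^sub>e)"
    by (simp add: sinr_bound_def Let_def cmod_hprod_commute [of "p k"])
qed

end
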